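(* Let $d,m,\zeta\in\mathbb N$. Let $\psi:\mathbb R\to\mathbb R$ be real analytic at some $\eta\in\mathbb R$ and not a polynomial there, and let $\phi$ be the softmax function. For all $\theta=(Z,u,W,b,V)\in\mathbb R^{d\times\zeta}\times\mathbb R^{\mathbb N}\times\mathbb R^{d\times m}\times\mathbb R^m\times\mathbb R^{m\times\zeta}$, define $$h_\theta:\bigcup_{t=1}^\infty[\zeta]^t\to\mathbb R^\zeta,\qquad\alpha\mapsto\phi\left(V^\top\psi\left(W^\top\sum_{t=1}^{|\alpha|}u_tz_{\alpha_t}+b\right)\right),$$ where $z_\gamma\in\mathbb R^d$ denotes the $\gamma$-th column of $Z$ and $\psi$ is applied entrywise. Then the next-token prediction capacity of $\{h_\theta\mid\theta\}$ is greater than or equal to $m$.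
   Context: $[\zeta]=\{1,\ldots,\zeta\}$; $|\alpha|$ is the length of the sequence $\alpha$. $\phi(x)_i=\exp(x_i)/\sum_{j}\exp(x_j)$. $\mathrm{ri}\,\Delta^{\zeta-1}=\{x\in\mathbb R^\zeta\mid x_i>0\ \forall i,\ \sum_ix_i=1\}$. "$\psi$ is real analytic at $\eta$ and not a polynomial there" means $\psi$ equals its Taylor series at $\eta$ on a neighborhood of $\eta$ and this series has infinitely many nonzero coefficients. The next-token prediction capacity of $\{h_\theta\mid\theta\}$ is the largest $n\in\mathbb N$ such that for every list of distinct $\alpha^1,\ldots,\alpha^n\in\bigcup_{t=1}^\infty[\zeta]^t$ and every list $y_1,\ldots,y_n\in\mathrm{ri}\,\Delta^{\zeta-1}$ there exists $\theta$ such that $y_i=h_\theta(\alpha^i)$ for all $i\in[n]$ (it is $\infty$ if every $n$ has this property). *)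

theory Defs
  imports "HOL-Analysis.Analysis" "HOL-Library.Extended_Nat"
begin

(* Vocabulary {1..zeta}, embedding space R^d and hidden layer R^m are indexed by the finite
   types 'z, 'd and 'm, so zeta, d, m >= 1 hold automatically. A p x q matrix has type
   real ^ 'q ^ 'p. *)

definition softmax :: "real ^ 'z \<Rightarrow> real ^ 'z" where
  "softmax x = (\<chi> i. exp (x $ i) / (\<Sum>j\<in>UNIV. exp (x $ j)))"

definition ri_simplex :: "(real ^ 'z) set" where
  "ri_simplex = {x. (\<forall>i. x $ i > 0) \<and> (\<Sum>i\<in>UNIV. x $ i) = 1}"

(* No separate smoothness hypothesis is needed: the first conjunct makes psi a convergent power
   series near eta, so the iterated deriv at eta are genuine derivatives. *)
definition analytic_nonpoly_at :: "(real \<Rightarrow> real) \<Rightarrow> real \<Rightarrow> bool" where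
  "analytic_nonpoly_at \<psi> \<eta> \<longleftrightarrow>
     (\<forall>\<^sub>F x in nhds \<eta>. (\<lambda>k. (deriv ^^ k) \<psi> \<eta> / fact k * (x - \<eta>) ^ k) sums \<psi> x) \<and>
     infinite {k. (deriv ^^ k) \<psi> \<eta> / fact k \<noteq> 0}"

type_synonym ('d, 'm, 'z) params =
  "(real ^ 'z ^ 'd) \<times> (nat \<Rightarrow> real) \<times> (real ^ 'm ^ 'd) \<times> (real ^ 'm) \<times> (real ^ 'z ^ 'm)"

(* Sequences are lists; t runs from 1, whereas list positions start at 0, and u 0 is never used. *)
definition token_model ::
    "(real \<Rightarrow> real) \<Rightarrow> ('d::finite, 'm::finite, 'z::finite) params \<Rightarrow> 'z list \<Rightarrow> real ^ 'z" where
  "token_model \<psi> = (\<lambda>(Z, u, W, b, V) \<alpha>.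
     softmax (transpose V *v
       (\<chi> i. \<psi> ((transpose W *v (\<Sum>t=1..length \<alpha>. u t *\<^sub>R column (\<alpha> ! (t - 1)) Z) + b) $ i))))"

definition interpolates :: "('z list \<Rightarrow> real ^ 'z) set \<Rightarrow> nat \<Rightarrow> bool" where
  "interpolates H n \<longleftrightarrow>
     (\<forall>\<alpha>s ys. length \<alpha>s = n \<and> distinct \<alpha>s \<and> [] \<notin> set \<alpha>s \<and>
        length ys = n \<and> set ys \<subseteq> ri_simplex \<longrightarrow>
        (\<exists>h\<in>H. \<forall>i<n. ys ! i = h (\<alpha>s ! i)))"

(* For the equivalence with "largest n, or infinity if every n works" see
   prediction_capacity_eq below. *)
definition prediction_capacity :: "('z list \<Rightarrow> real ^ 'z) set \<Rightarrow> enat" where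
  "prediction_capacity H = Sup {enat n | n. interpolates H n}"

lemma interpolates_Suc:
  fixes H :: "('z::finite list \<Rightarrow> real ^ 'z) set"
  assumes "interpolates H (Suc n)"
  shows "interpolates H n"
  unfolding interpolates_def
proof (intro allI impI, elim conjE)
  fix \<alpha>s :: "'z list list" and ys :: "(real ^ 'z) list"
  assume a: "length \<alpha>s = n" "distinct \<alpha>s" "[] \<notin> set \<alpha>s"
    and y: "length ys = n" "set ys \<subseteq> ri_simplex"
  have "infinite (UNIV - insert [] (set \<alpha>s))"
    by (simp add: Diff_infinite_finite infinite_UNIV_listI)
  then obtain \<beta> where "\<beta> \<notin> insert [] (set \<alpha>s)"
    using infinite_imp_nonempty by blast
  moreover have "(\<chi> i. 1 / real CARD('z)) \<in> (ri_simplex :: (real ^ 'z) set)"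
    by (simp add: ri_simplex_def)
  ultimately obtain h where "h \<in> H"
    and h: "\<forall>i<Suc n. (ys @ [\<chi> i. 1 / real CARD('z)]) ! i = h ((\<alpha>s @ [\<beta>]) ! i)"
    using assms[unfolded interpolates_def, rule_format,
        of "\<alpha>s @ [\<beta>]" "ys @ [\<chi> i. 1 / real CARD('z)]"] a y by auto
  have "\<forall>i<n. ys ! i = h (\<alpha>s ! i)"
  proof (intro allI impI)
    fix i assume "i < n"
    then show "ys ! i = h (\<alpha>s ! i)"
      using h[rule_format, of i] a(1) y(1) by (simp add: nth_append)
  qed
  then show "\<exists>h\<in>H. \<forall>i<n. ys ! i = h (\<alpha>s ! i)" using \<open>h \<in> H\<close> by blast
qed

lemma interpolates_antimono:
  fixes H :: "('z::finite list \<Rightarrow> real ^ 'z) set"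
  assumes "interpolates H n" "k \<le> n"
  shows "interpolates H k"
  using assms(2,1) by (induction rule: dec_induct) (auto dest: interpolates_Suc)

lemma prediction_capacity_eq:
  fixes H :: "('z::finite list \<Rightarrow> real ^ 'z) set"
  assumes "H \<noteq> {}"
  shows "prediction_capacity H =
    (if \<forall>n. interpolates H n then \<infinity> else enat (GREATEST n. interpolates H n))"
proof (cases "\<forall>n. interpolates H n")
  case True
  have ge: "enat n \<le> prediction_capacity H" for n
    unfolding prediction_capacity_def using True by (intro Sup_upper) auto
  have "prediction_capacity H = \<infinity>"
  proof (cases "prediction_capacity H")
    case (enat k)
    with ge[of "Suc k"] show ?thesis by simp
  qed simp
  with True show ?thesis by simp
next
  case False
  then obtain N where N: "\<not> interpolates H N" by blast
  have bound: "n \<le> N" if "interpolates H n" for n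
    using N interpolates_antimono[OF that, of N] by linarith
  have "interpolates H 0" using assms by (auto simp: interpolates_def)
  then have G: "interpolates H (GREATEST n. interpolates H n)"
    using bound by (rule GreatestI_nat)
  have "prediction_capacity H = enat (GREATEST n. interpolates H n)"
    unfolding prediction_capacity_def
  proof (rule Sup_eqI)
    fix x assume "x \<in> {enat n | n. interpolates H n}"
    then obtain n where "x = enat n" "interpolates H n" by blast
    moreover from this(2) have "n \<le> (GREATEST n. interpolates H n)"
      using bound by (rule Greatest_le_nat)
    ultimately show "x \<le> enat (GREATEST n. interpolates H n)" by simp
  qed (use G in blast)
  with False show ?thesis by auto
qed

end

theory Submission
  imports Defs "HOL-Complex_Analysis.Cauchy_Integral_Formula"
begin

text \<open>
  Reading the tokens as nonzero digits and taking for \<open>u\<close> the powers of a base larger than the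
  alphabet, distinct sequences obtain distinct positive codes \<open>x\<^sub>1, \<dots>, x\<^sub>m\<close>. The vectors
  \<open>(\<psi> (\<eta> + w x\<^sub>j))\<^sub>j\<close>, where \<open>w\<close> ranges over the reals, span the whole space: for a vector \<open>c\<close>
  orthogonal to all of them, comparing coefficients in the Taylor series gives
  \<open>\<Sum>\<^sub>j c\<^sub>j x\<^sub>j\<^sup>k = 0\<close> for infinitely many \<open>k\<close>, and the largest \<open>x\<^sub>j\<close> with \<open>c\<^sub>j \<noteq> 0\<close> dominates such a sum.
  Hence \<open>m\<close> values of \<open>w\<close> make the matrix of hidden activations invertible, and \<open>V\<close> can be
  solved for so that the logits are the logarithms of the prescribed probabilities.
\<close>

lemma power_sums_zero_imp_zero:
  fixes c x :: "'a::finite \<Rightarrow> real"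
  assumes inj: "inj x" and pos: "\<And>j. x j > 0"
    and inf: "infinite {k. (\<Sum>j\<in>UNIV. c j * x j ^ k) = 0}"
  shows "c j = 0"
proof (rule ccontr)
  assume "c j \<noteq> 0"
  define J where "J = {j. c j \<noteq> 0}"
  have "finite (x ` J)" "x ` J \<noteq> {}"
    using \<open>c j \<noteq> 0\<close> by (auto simp: J_def)
  then obtain l where l: "l \<in> J" "x l = Max (x ` J)"
    using Max_in by (metis imageE)
  have less: "x i < x l" if "i \<in> J" "i \<noteq> l" for i
    using that l \<open>finite (x ` J)\<close> inj
    by (metis Max_ge imageI injD order_le_imp_less_or_eq)
  \<comment> \<open>Rescaled by \<open>x l ^ k\<close>, the power sum keeps only its dominant term
    in the limit: ratios inside \<open>J\<close> other than the \<open>l\<close>-th are below 1, and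
    terms outside \<open>J\<close> vanish identically.\<close>
  have "(\<lambda>k. c i * (x i / x l) ^ k) \<longlonglongrightarrow> (if i = l then c l else 0)" for i
  proof (cases "i \<in> J \<and> i \<noteq> l")
    case True
    then have "(\<lambda>k. (x i / x l) ^ k) \<longlonglongrightarrow> 0"
      using less[of i] pos[of i] pos[of l] by (intro LIMSEQ_realpow_zero) auto
    then show ?thesis
      using True tendsto_mult_right_zero by auto
  next
    case False
    then show ?thesis
      using pos[of l] by (auto simp: J_def)
  qed
  then have "(\<lambda>k. \<Sum>i\<in>UNIV. c i * (x i / x l) ^ k) \<longlonglongrightarrow> (\<Sum>i\<in>UNIV. if i = l then c l else 0)"
    by (intro tendsto_sum)
  then have "(\<lambda>k. \<Sum>i\<in>UNIV. c i * (x i / x l) ^ k) \<longlonglongrightarrow> c l"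
    by simp
  moreover have "c l \<noteq> 0"
    using l by (simp add: J_def)
  ultimately have "\<forall>\<^sub>F k in sequentially. (\<Sum>i\<in>UNIV. c i * (x i / x l) ^ k) \<noteq> 0"
    by (rule tendsto_imp_eventually_ne)
  moreover have "(\<Sum>i\<in>UNIV. c i * (x i / x l) ^ k) = (\<Sum>i\<in>UNIV. c i * x i ^ k) / x l ^ k" for k
    by (simp add: power_divide sum_divide_distrib)
  ultimately have "\<forall>\<^sub>F k in sequentially. (\<Sum>i\<in>UNIV. c i * x i ^ k) \<noteq> 0"
    by (simp add: eventually_conj_iff)
  then show False
    using inf by (simp add: cofinite_eq_sequentially[symmetric] eventually_cofinite)
qed

lemma span_activations:
  fixes x :: "'m::finite \<Rightarrow> real"
  assumes an: "analytic_nonpoly_at \<psi> \<eta>" and inj: "inj x" and pos: "\<And>j. x j > 0"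
  shows "span (range (\<lambda>w. (\<chi> j. \<psi> (\<eta> + w * x j)) :: real ^ 'm)) = UNIV" (is "span (range ?v) = _")
proof (rule ccontr)
  assume "span (range ?v) \<noteq> UNIV"
  then obtain c where "c \<noteq> 0" and c: "\<And>a. a \<in> span (range ?v) \<Longrightarrow> c \<bullet> a = 0"
    using span_not_UNIV_orthogonal by blast
  have zero: "(\<Sum>j\<in>UNIV. c $ j * \<psi> (\<eta> + w * x j)) = 0" for w
    using c[OF span_base[of "?v w"]] by (simp add: inner_vec_def)
  define a where "a k = (deriv ^^ k) \<psi> \<eta> / fact k" for k
  define p where "p k = (\<Sum>j\<in>UNIV. c $ j * x j ^ k)" for k
  obtain r where "r > 0" and r: "\<And>y. \<bar>y - \<eta>\<bar> < r \<Longrightarrow> (\<lambda>k. a k * (y - \<eta>) ^ k) sums \<psi> y"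
    using an unfolding analytic_nonpoly_at_def eventually_nhds_metric a_def dist_real_def by blast
  define M where "M = Max (range x)"
  have M: "x j \<le> M" for j
    by (simp add: M_def)
  have "M > 0"
    using M pos by (meson less_le_trans)
  \<comment> \<open>The radius \<open>r / M\<close> keeps all points \<open>w * x j\<close> within
    reach of the Taylor expansion at once, so the finitely many series can be added
    termwise.\<close>
  have sums: "(\<lambda>k. (a k * p k) * w ^ k) sums 0" if "\<bar>w\<bar> < r / M" for w
  proof -
    have "\<bar>w * x j\<bar> < r" for j
    proof -
      have "\<bar>w * x j\<bar> \<le> \<bar>w\<bar> * M"
        using M[of j] pos[of j] by (simp add: abs_mult mult_left_mono)
      also have "\<dots> < r"
        using that \<open>M > 0\<close> by (simp add: field_simps)
      finally show ?thesis .
    qed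
    then have "(\<lambda>k. a k * (w * x j) ^ k) sums \<psi> (\<eta> + w * x j)" for j
      using r[of "\<eta> + w * x j"] by simp
    then have "(\<lambda>k. \<Sum>j\<in>UNIV. c $ j * (a k * (w * x j) ^ k)) sums
        (\<Sum>j\<in>UNIV. c $ j * \<psi> (\<eta> + w * x j))"
      by (intro sums_sum sums_mult)
    moreover have "(\<Sum>j\<in>UNIV. c $ j * (a k * (w * x j) ^ k)) = (a k * p k) * w ^ k" for k
      by (simp add: p_def sum_distrib_left sum_distrib_right power_mult_distrib mult_ac)
    ultimately show ?thesis
      by (simp add: zero)
  qed
  \<comment> \<open>A nonzero coefficient of positive index would make 0 an isolated zero of the
    sum, yet the sum is the zero function. Index 0 is excluded because
    \<open>powser_0_nonzero\<close> asks for a positive index; dropping it leaves infinitely many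
    \<open>k\<close>.\<close>
  have ap: "a k * p k = 0" if "k > 0" for k
  proof (rule ccontr)
    assume "a k * p k \<noteq> 0"
    show False
    proof (rule powser_0_nonzero[of "r / M" 0 "\<lambda>k. a k * p k" "\<lambda>_. 0" k])
      fix s :: real
      assume "0 < s" and "\<And>z::real. z \<in> cball 0 s - {0} \<Longrightarrow> (0::real) \<noteq> 0"
      from this(2)[of s] \<open>s > 0\<close> show False
        by simp
    qed (use sums \<open>r > 0\<close> \<open>M > 0\<close> \<open>a k * p k \<noteq> 0\<close> \<open>k > 0\<close> in auto)
  qed
  have "infinite ({k. a k \<noteq> 0} - {0})"
    using an by (simp add: analytic_nonpoly_at_def a_def)
  then have "infinite {k. p k = 0}"
    by (rule contrapos_nn) (erule finite_subset[rotated], use ap in auto)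
  then have "c $ j = 0" for j
    unfolding p_def by (rule power_sums_zero_imp_zero[OF inj pos])
  with \<open>c \<noteq> 0\<close> show False
    by (simp add: vec_eq_iff)
qed

text \<open>A spanning range contains a basis, which has as many vectors as \<open>'m\<close> has
  elements. With these as rows the matrix is square and its rows span, which is equivalent to left
  invertibility.\<close>

lemma left_invertible_rows_from_spanning_range:
  fixes v :: "'a \<Rightarrow> real ^ 'm"
  assumes "span (range v) = UNIV"
  obtains w :: "'m \<Rightarrow> 'a" and B :: "real ^ 'm ^ 'm" where "B ** (\<chi> i. v (w i)) = mat 1"
proof -
  obtain S where S: "S \<subseteq> range v" "independent S" "range v \<subseteq> span S" "card S = dim (range v)"
    using basis_exists by blast
  have "card S = CARD('m)"
    using S(4) assms by (metis dim_span dim_UNIV DIM_cart DIM_real mult.right_neutral)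
  moreover have "finite S"
    using S(2) by (rule independent_imp_finite)
  ultimately obtain f where f: "bij_betw f (UNIV :: 'm set) S"
    by (metis finite_same_card_bij finite)
  define w where "w i = (SOME a. f i = v a)" for i
  have w: "v (w i) = f i" for i
  proof -
    have "\<exists>a. f i = v a"
      using S(1) f by (auto simp: bij_betw_def)
    then show ?thesis
      unfolding w_def by (metis (mono_tags) someI_ex)
  qed
  have "rows (\<chi> i. v (w i)) = S"
    using f by (auto simp: rows_def row_def w bij_betw_def image_def)
  moreover have "span S = UNIV"
    using S(3) assms by (metis span_minimal subspace_span top.extremum_uniqueI)
  ultimately show thesis
    using that matrix_left_invertible_span_rows by metis
qed

text \<open>By Horner's scheme the head is the code modulo \<open>N\<close> and the tail is what
  remains. Excluding the digit 0 makes the length recoverable too, since trailing zeros would not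
  change the code.\<close>

lemma digit_expansion_inj:
  fixes c :: "'a \<Rightarrow> nat"
  assumes inj: "inj c" and pos: "\<And>a. 0 < c a" and less: "\<And>a. c a < N"
  assumes "(\<Sum>t<length \<alpha>. N ^ t * c (\<alpha> ! t)) = (\<Sum>t<length \<beta>. N ^ t * c (\<beta> ! t))"
  shows "\<alpha> = \<beta>"
proof -
  define e where "e \<gamma> = (\<Sum>t<length \<gamma>. N ^ t * c (\<gamma> ! t))" for \<gamma>
  have c_neq_0: "c a \<noteq> 0" for a
    using pos[of a] by simp
  have e_Nil: "e [] = 0"
    by (simp add: e_def)
  have e_Cons: "e (a # \<gamma>) = c a + N * e \<gamma>" for a \<gamma>
    by (simp add: e_def sum.lessThan_Suc_shift sum_distrib_left mult_ac del: sum.lessThan_Suc)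
  have "e \<alpha> = e \<beta> \<Longrightarrow> \<alpha> = \<beta>"
  proof (induction \<alpha> arbitrary: \<beta>)
    case Nil
    then show ?case
      using c_neq_0 by (cases \<beta>) (auto simp: e_Nil e_Cons)
  next
    case (Cons a \<alpha>)
    then obtain b \<beta>' where \<beta>: "\<beta> = b # \<beta>'"
      using c_neq_0 by (cases \<beta>) (auto simp: e_Nil e_Cons)
    have eq: "c a + N * e \<alpha> = c b + N * e \<beta>'"
      using Cons.prems by (simp add: \<beta> e_Cons)
    from arg_cong[OF this, of "\<lambda>n. n mod N"] have "c a = c b"
      using less by simp
    \<comment> \<open>The bound on \<open>c a\<close> also gives \<open>N > 0\<close>, so the factor
      \<open>N\<close> can be cancelled.\<close>
    moreover from this eq have "e \<alpha> = e \<beta>'"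
      using less[of a] by simp
    ultimately show ?case
      using Cons.IH inj by (auto simp: \<beta> inj_eq)
  qed
  with assms(4) show ?thesis
    by (simp add: e_def)
qed

text \<open>Positivity of the entries lets \<open>exp\<close> undo \<open>ln\<close>, and the
  denominator is then their sum, which is 1.\<close>

lemma softmax_ln:
  assumes "y \<in> ri_simplex"
  shows "softmax (\<chi> i. ln (y $ i)) = y"
  using assms by (simp add: softmax_def ri_simplex_def vec_eq_iff)

lemma interpolates_token_model:
  assumes an: "analytic_nonpoly_at \<psi> \<eta>"
  shows "interpolates {token_model \<psi> \<theta> | \<theta> :: ('d::finite, 'm::finite, 'z::finite) params. True}
    CARD('m)"
  unfolding interpolates_def
proof (intro allI impI, elim conjE)
  fix \<alpha>s :: "'z list list" and ys :: "(real ^ 'z) list"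
  assume len: "length \<alpha>s = CARD('m)" and dist: "distinct \<alpha>s" and ne: "[] \<notin> set \<alpha>s"
    and len': "length ys = CARD('m)" and ys: "set ys \<subseteq> ri_simplex"
  \<comment> \<open>Indexing the sequences by \<open>'m\<close>, like the hidden units, makes the
    activation matrix square.\<close>
  obtain g :: "'m \<Rightarrow> nat" where g: "bij_betw g UNIV {..<CARD('m)}"
    by (metis finite_same_card_bij finite finite_lessThan card_lessThan)
  have g_less: "g j < CARD('m)" for j
    using g by (auto simp: bij_betw_def)
  obtain c0 :: "'z \<Rightarrow> nat" where c0: "bij_betw c0 UNIV {..<CARD('z)}"
    by (metis finite_same_card_bij finite finite_lessThan card_lessThan)
  define N where "N = Suc CARD('z)"
  define c where "c = (\<lambda>\<gamma>. Suc (c0 \<gamma>))"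
  have c: "inj c" "\<And>\<gamma>. 0 < c \<gamma>" "\<And>\<gamma>. c \<gamma> < N"
    using c0 by (auto simp: bij_betw_def inj_def c_def N_def)
  define e where "e \<alpha> = (\<Sum>t<length \<alpha>. N ^ t * c (\<alpha> ! t))" for \<alpha>
  define x where "x j = real (e (\<alpha>s ! g j))" for j
  have e_inj: "\<alpha> = \<beta>" if "e \<alpha> = e \<beta>" for \<alpha> \<beta>
    using digit_expansion_inj[OF c] that by (simp add: e_def)
  have "inj x"
  proof (rule injI)
    fix i j assume "x i = x j"
    then have "\<alpha>s ! g i = \<alpha>s ! g j"
      by (auto simp: x_def intro: e_inj)
    then have "g i = g j"
      using dist len g_less by (simp add: nth_eq_iff_index_eq)
    then show "i = j"
      using g by (auto simp: bij_betw_def inj_eq)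
  qed
  moreover have "x j > 0" for j
  proof -
    have "\<alpha>s ! g j \<noteq> []"
      using ne len g_less by (metis nth_mem)
    \<comment> \<open>The empty list has code 0, and no other list shares it.\<close>
    then have "e (\<alpha>s ! g j) \<noteq> 0"
      using e_inj[of "\<alpha>s ! g j" "[]"] by (auto simp: e_def[of "[]"])
    then show ?thesis
      by (simp add: x_def)
  qed
  ultimately have "span (range (\<lambda>w. (\<chi> j. \<psi> (\<eta> + w * x j)) :: real ^ 'm)) = UNIV"
    using an by (intro span_activations)
  \<comment> \<open>Rows of \<open>?A\<close> belong to hidden units, columns to sequences.\<close>
  then obtain w :: "'m \<Rightarrow> real" and B :: "real ^ 'm ^ 'm"
    where B: "B ** (\<chi> i j. \<psi> (\<eta> + w i * x j)) = mat 1" (is "B ** ?A = _")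
    by (rule left_invertible_rows_from_spanning_range)
  define Y :: "real ^ 'm ^ 'z" where "Y = (\<chi> k j. ln (ys ! g j $ k))"
  \<comment> \<open>All rows of \<open>Z\<close> agree, so each sequence is embedded as a constant
    vector with entry \<open>x j\<close>; the division by \<open>CARD('d)\<close> in
    \<open>W\<close> offsets the sum over these equal coordinates.\<close>
  define Z :: "real ^ 'z ^ 'd" where "Z = (\<chi> i \<gamma>. real (c \<gamma>))"
  define W :: "real ^ 'm ^ 'd" where "W = (\<chi> i k. w k / CARD('d))"
  \<comment> \<open>Positions in the model start at 1, exponents of the code at 0.\<close>
  define u where "u t = real (N ^ (t - 1))" for t
  \<comment> \<open>The model transposes its last parameter, so the logits are \<open>Y ** B\<close>
    applied to a column of \<open>?A\<close>, and \<open>B ** ?A = mat 1\<close> reduces them to the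
    columns of \<open>Y\<close>.\<close>
  define h where "h = token_model \<psi> (Z, u, W, (\<chi> i. \<eta>) :: real ^ 'm, transpose (Y ** B))"
  have "h (\<alpha>s ! g j) = ys ! g j" for j
  proof -
    let ?\<alpha> = "\<alpha>s ! g j"
    have "(\<Sum>t=1..length ?\<alpha>. u t *\<^sub>R column (?\<alpha> ! (t - 1)) Z) =
        (\<Sum>t<length ?\<alpha>. u (Suc t) *\<^sub>R column (?\<alpha> ! t) Z)"
      by (simp add: sum.atLeast1_atMost_eq)
    also have "\<dots> = (\<chi> i. x j)"
      by (simp add: vec_eq_iff column_def u_def Z_def x_def e_def)
    finally have emb: "(\<Sum>t=1..length ?\<alpha>. u t *\<^sub>R column (?\<alpha> ! (t - 1)) Z) = (\<chi> i. x j)" .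
    have "(transpose W *v (\<chi> i. x j) + (\<chi> i. \<eta>)) $ i = \<eta> + w i * x j" for i
      by (simp add: matrix_vector_mult_def transpose_def W_def)
    then have "(\<chi> i. \<psi> ((transpose W *v (\<chi> i. x j) + (\<chi> i. \<eta>)) $ i)) = column j ?A"
      by (simp add: column_def add.commute)
    then have "h ?\<alpha> = softmax ((Y ** B) *v column j ?A)"
      by (simp add: h_def token_model_def emb transpose_transpose del: One_nat_def)
    also have "(Y ** B) *v column j ?A = column j ((Y ** B) ** ?A)"
      by (simp add: vec_eq_iff column_def matrix_vector_mult_def matrix_matrix_mult_def)
    also have "\<dots> = column j Y"
      by (simp add: matrix_mul_assoc[symmetric] B)
    also have "\<dots> = (\<chi> k. ln (ys ! g j $ k))"
      by (simp add: column_def Y_def)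
    also have "softmax \<dots> = ys ! g j"
      using ys len' g_less by (intro softmax_ln) (auto dest: nth_mem)
    finally show ?thesis .
  qed
  moreover have "\<exists>j. i = g j" if "i < CARD('m)" for i
    using g that by (auto simp: bij_betw_def)
  ultimately have "\<forall>i<CARD('m). ys ! i = h (\<alpha>s ! i)"
    by metis
  then show "\<exists>h\<in>{token_model \<psi> \<theta> | \<theta> :: ('d, 'm, 'z) params. True}.
      \<forall>i<CARD('m). ys ! i = h (\<alpha>s ! i)"
    unfolding h_def by blast
qed

theorem theorem23:
  fixes \<psi> :: "real \<Rightarrow> real" and \<eta> :: real
  assumes "analytic_nonpoly_at \<psi> \<eta>"
  shows "prediction_capacity
           {token_model \<psi> \<theta> | \<theta> :: ('d::finite, 'm::finite, 'z::finite) params. True}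
         \<ge> enat CARD('m)"
  unfolding prediction_capacity_def
  using interpolates_token_model[OF assms] by (intro Sup_upper) blast

end
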